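(* Let $A,J\in\mathbb{R}^{n\times n}$ and $0<\delta\le T_{min}\le T_{max}<\infty$. Consider the impulsive system $$\dot x(t)=Ax(t),\ t\notin\{t_k\}_{k\in\mathbb{N}},\qquad x(t)=Jx(t^-),\ t\in\{t_k\}_{k\in\mathbb{N}},\qquad x(t_0)=x_0,$$ with inter-impulse times $T_k:=t_{k+1}-t_k\in[T_{min},T_{max}]$. Then the following statements (a) and (b) are equivalent, and if they hold then the system is asymptotically stable: (a) There exists a matrix $P\in\mathbb{S}^n_{\succ0}$ such that $J^{\top}e^{A^{\top}\theta}Pe^{A\theta}J-P\prec0$ for all $\theta\in[T_{min},T_{max}]$. (b) There exist a constant matrix $P\in\mathbb{S}^n_{\succ0}$, a scalar $\varepsilon>0$ and a matrix function $Z:[0,T_{max}]\times[T_{min},T_{max}]\to\mathbb{S}^{3n}$, differentiable with respect to the first variable, verifying $$Y_2^{\top}Z(\theta,\theta)Y_2-Y_1^{\top}Z(0,\theta)Y_1=0\quad\text{for all }\theta\in[T_{min},T_{max}],$$ where $$Y_1=\begin{bmatrix}J&0_n\\ I_n&0_n\\ 0_n&I_n\end{bmatrix},\qquad Y_2=\begin{bmatrix}0_n&I_n\\ I_n&0_n\\ 0_n&I_n\end{bmatrix},$$ and such that $$\Theta(\theta)+\operatorname{He}\left(Z(\tau,\theta)\begin{bmatrix}A&0_n&0_n\\0_n&0_n&0_n\\0_n&0_n&0_n\end{bmatrix}\right)+\frac{\partial}{\partial\tau}Z(\tau,\theta)\preceq0$$ for all $\tau\in[0,\theta]$ and all $\theta\in[T_{min},T_{max}]$,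 where $$\Theta(\theta):=\begin{bmatrix}\theta\operatorname{He}[PA]&0_n&0_n\\0_n&\varepsilon I_n+J^{\top}PJ-P&0_n\\0_n&0_n&0_n\end{bmatrix}.$$
   Context: Notation: $\mathbb{N}=\{1,2,\dots\}$, $\mathbb{N}_0=\mathbb{N}\cup\{0\}$; $\mathbb{S}^m$ is the set of real symmetric $m\times m$ matrices, $\mathbb{S}^m_{\succ0}$ the positive definite ones; $X\prec Y$ (resp. $X\preceq Y$) means $Y-X$ is positive definite (resp. semidefinite); $\operatorname{He}(X):=X+X^{\top}$; $0_n$ and $I_n$ are the $n\times n$ zero and identity matrices. The admissible sequences of impulse times are $\{t_k\}_{k\in\mathbb{N}}$ with $t_0=0$ and $t_{k+1}-t_k\in[T_{min},T_{max}]$ for all $k\in\mathbb{N}_0$. The state $x(t)\in\mathbb{R}^n$ is right-continuous, and $x(t^-)$ denotes its left limit at $t$. The system is asymptotically stable if, for every admissible sequence, the zero solution is Lyapunov stable and $x(t)\to0$ as $t\to\infty$ for every $x_0\in\mathbb{R}^n$. *)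

theory Defs
  imports "HOL-Analysis.Analysis"
begin

section \<open>Matrices\<close>

(* The multiplication that the type classes provide on real^'n^'n is entrywise, so neither the
   class power operation nor exp is the intended one; powers are taken with respect to (**). *)
definition mexp :: "real^'n^'n \<Rightarrow> real^'n^'n" where
  "mexp M = (\<Sum>k. (1 / fact k) *\<^sub>R (((**) M ^^ k) (mat 1)))"

definition sym_mat :: "real^'m^'m \<Rightarrow> bool" where
  "sym_mat M \<longleftrightarrow> transpose M = M"

definition pos_def :: "real^'m^'m \<Rightarrow> bool" where
  "pos_def M \<longleftrightarrow> sym_mat M \<and> (\<forall>v. v \<noteq> 0 \<longrightarrow> 0 < v \<bullet> (M *v v))"

definition pos_semidef :: "real^'m^'m \<Rightarrow> bool" where
  "pos_semidef M \<longleftrightarrow> sym_mat M \<and> (\<forall>v. 0 \<le> v \<bullet> (M *v v))"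

abbreviation loewner_less :: "real^'m^'m \<Rightarrow> real^'m^'m \<Rightarrow> bool" (infix "\<prec>\<^sub>L" 50) where
  "X \<prec>\<^sub>L Y \<equiv> pos_def (Y - X)"

abbreviation loewner_le :: "real^'m^'m \<Rightarrow> real^'m^'m \<Rightarrow> bool" (infix "\<preceq>\<^sub>L" 50) where
  "X \<preceq>\<^sub>L Y \<equiv> pos_semidef (Y - X)"

definition He :: "real^'m^'m \<Rightarrow> real^'m^'m" where
  "He X = X + transpose X"

(* Block matrices are indexed by sum types, so 'n + 'n + 'n plays the role of {1..3n}.
   X ||| Y places Y to the right of X, and X === Y places Y below X. *)
definition hcat :: "real^'a^'m \<Rightarrow> real^'b^'m \<Rightarrow> real^('a + 'b)^'m" (infixr "|||" 60) where
  "X ||| Y = (\<chi> i j. case j of Inl a \<Rightarrow> X $ i $ a | Inr b \<Rightarrow> Y $ i $ b)"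

definition vcat :: "real^'m^'a \<Rightarrow> real^'m^'b \<Rightarrow> real^'m^('a + 'b)" (infixr "===" 55) where
  "X === Y = (\<chi> i. case i of Inl a \<Rightarrow> X $ a | Inr b \<Rightarrow> Y $ b)"


section \<open>The impulsive system\<close>

(* t 0 = 0 is the initial time; the impulses occur at t k for k \<ge> 1 only. *)
definition admissible_times :: "real \<Rightarrow> real \<Rightarrow> (nat \<Rightarrow> real) \<Rightarrow> bool" where
  "admissible_times Tmin Tmax t \<longleftrightarrow>
     t 0 = 0 \<and> (\<forall>k. t (Suc k) - t k \<in> {Tmin..Tmax})"

(* Trajectories live on [0, \<infinity>); values of x at negative arguments are irrelevant, and the
   derivative at time 0 is the right derivative. *)
definition impulsive_solution ::
  "real^'n^'n \<Rightarrow> real^'n^'n \<Rightarrow> (nat \<Rightarrow> real) \<Rightarrow> real^'n \<Rightarrow> (real \<Rightarrow> real^'n) \<Rightarrow> bool" where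
  "impulsive_solution A J t x0 x \<longleftrightarrow>
     x (t 0) = x0 \<and>
     (\<forall>s\<ge>0. s \<notin> t ` {1..} \<longrightarrow> (x has_vector_derivative A *v x s) (at s within {0..})) \<and>
     (\<forall>k\<ge>1. continuous (at_right (t k)) x \<and>
            (\<exists>xminus. (x \<longlongrightarrow> xminus) (at_left (t k)) \<and> x (t k) = J *v xminus))"

(* For Tmin > 0 every initial state has exactly one trajectory on [0, \<infinity>), so quantifying over
   all trajectories is the same as speaking of the trajectory starting at x0. *)
definition lyapunov_stable :: "real^'n^'n \<Rightarrow> real^'n^'n \<Rightarrow> (nat \<Rightarrow> real) \<Rightarrow> bool" where
  "lyapunov_stable A J t \<longleftrightarrow>
     (\<forall>e>0. \<exists>d>0. \<forall>x0 x. norm x0 < d \<longrightarrow> impulsive_solution A J t x0 x \<longrightarrow>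
        (\<forall>s\<ge>0. norm (x s) < e))"

definition asymptotically_stable :: "real^'n^'n \<Rightarrow> real^'n^'n \<Rightarrow> real \<Rightarrow> real \<Rightarrow> bool" where
  "asymptotically_stable A J Tmin Tmax \<longleftrightarrow>
     (\<forall>t. admissible_times Tmin Tmax t \<longrightarrow>
        lyapunov_stable A J t \<and>
        (\<forall>x0 x. impulsive_solution A J t x0 x \<longrightarrow> (x \<longlongrightarrow> 0) at_top))"


section \<open>The two matrix inequality conditions\<close>

definition discrete_time_condition :: "real^'n^'n \<Rightarrow> real^'n^'n \<Rightarrow> real \<Rightarrow> real \<Rightarrow> bool" where
  "discrete_time_condition A J Tmin Tmax \<longleftrightarrow>
     (\<exists>P. pos_def P \<and>
        (\<forall>\<theta>\<in>{Tmin..Tmax}.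
           transpose J ** mexp (\<theta> *\<^sub>R transpose A) ** P ** mexp (\<theta> *\<^sub>R A) ** J - P \<prec>\<^sub>L 0))"

definition Y1 :: "real^'n^'n \<Rightarrow> real^('n + 'n)^('n + 'n + 'n)" where
  "Y1 J = (J     ||| 0     ===
           mat 1 ||| 0     ===
           0     ||| mat 1)"

definition Y2 :: "real^('n::finite + 'n)^('n + 'n + 'n)" where
  "Y2 = (0     ||| mat 1 ===
         mat 1 ||| 0     ===
         0     ||| mat 1)"

definition A_aug :: "real^'n^'n \<Rightarrow> real^('n + 'n + 'n)^('n + 'n + 'n)" where
  "A_aug A = (A ||| 0 ||| 0 ===
              0 ||| 0 ||| 0 ===
              0 ||| 0 ||| 0)"

definition Theta ::
  "real^'n^'n \<Rightarrow> real^'n^'n \<Rightarrow> real^'n^'n \<Rightarrow> real \<Rightarrow> real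
     \<Rightarrow> real^('n + 'n + 'n)^('n + 'n + 'n)" where
  "Theta A J P \<epsilon> \<theta> =
     (\<theta> *\<^sub>R He (P ** A) ||| 0                                        ||| 0 ===
      0                ||| \<epsilon> *\<^sub>R mat 1 + transpose J ** P ** J - P   ||| 0 ===
      0                ||| 0                                        ||| 0)"

(* Z is required to be symmetric and differentiable only for arguments in
   [0, Tmax] \<times> [Tmin, Tmax], with one-sided derivatives at the end points of [0, Tmax]. *)
definition looped_functional_condition :: "real^'n^'n \<Rightarrow> real^'n^'n \<Rightarrow> real \<Rightarrow> real \<Rightarrow> bool" where
  "looped_functional_condition A J Tmin Tmax \<longleftrightarrow>
     (\<exists>P \<epsilon>. \<exists>Z :: real \<Rightarrow> real \<Rightarrow> real^('n + 'n + 'n)^('n + 'n + 'n).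
        pos_def P \<and> \<epsilon> > 0 \<and>
        (\<forall>\<tau>\<in>{0..Tmax}. \<forall>\<theta>\<in>{Tmin..Tmax}.
           sym_mat (Z \<tau> \<theta>) \<and> (\<lambda>s. Z s \<theta>) differentiable (at \<tau> within {0..Tmax})) \<and>
        (\<forall>\<theta>\<in>{Tmin..Tmax}.
           transpose Y2 ** Z \<theta> \<theta> ** Y2 - transpose (Y1 J) ** Z 0 \<theta> ** Y1 J = 0) \<and>
        (\<forall>\<theta>\<in>{Tmin..Tmax}. \<forall>\<tau>\<in>{0..\<theta>}.
           Theta A J P \<epsilon> \<theta> + He (Z \<tau> \<theta> ** A_aug A)
             + vector_derivative (\<lambda>s. Z s \<theta>) (at \<tau> within {0..Tmax}) \<preceq>\<^sub>L 0))"

end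

theory Submission
  imports Defs
begin

text \<open>
  Write \<open>\<Phi>(\<tau>) = e\<^bsup>A\<tau>\<^esup>\<close>. If (b) holds, evaluate \<open>Z(\<tau>, \<theta>)\<close> along
  \<open>w(\<tau>) = (\<Phi>(\<tau>)J\<xi>, \<xi>, \<Phi>(\<theta>)J\<xi>)\<close>, that is, along the state, the previous and the next pre-jump value.
  The matrix inequality says that \<open>w\<^sup>TZw + \<theta>(\<Phi>J\<xi>)\<^sup>TP(\<Phi>J\<xi>) + \<tau>\<xi>\<^sup>T(\<epsilon>I + J\<^sup>TPJ - P)\<xi>\<close> is nonincreasing in
  \<open>\<tau>\<close>, and the boundary condition says that its first term has the same value at \<open>0\<close> and \<open>\<theta>\<close>. Dividing the
  total decrease by \<open>\<theta>\<close> leaves (a) with margin \<open>\<epsilon>\<close>. Conversely, (a) has a uniform margin \<open>\<epsilon>\<close> by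
  compactness, and a block diagonal \<open>Z\<close> can be written down explicitly. For stability, \<open>v\<^sup>TPv\<close>
  contracts by a fixed factor from one pre-jump value to the next, and the flow is bounded on
  \<open>[0, T\<^sub>m\<^sub>a\<^sub>x]\<close>.
\<close>

section \<open>Matrix algebra\<close>

lemma bounded_bilinear_matrix_matrix_mult:
  "bounded_bilinear ((**) :: real^'n^'m \<Rightarrow> real^'p^'n \<Rightarrow> real^'p^'m)"
  unfolding bilinear_conv_bounded_bilinear [symmetric] bilinear_def
  by (auto intro!: linearI simp: matrix_matrix_mult_def vec_eq_iff sum.distrib sum_distrib_left
      algebra_simps)

lemmas matrix_mult_add_left = bounded_bilinear.add_left [OF bounded_bilinear_matrix_matrix_mult]
lemmas matrix_mult_minus_left = bounded_bilinear.minus_left [OF bounded_bilinear_matrix_matrix_mult]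
lemmas matrix_mult_minus_right = bounded_bilinear.minus_right [OF bounded_bilinear_matrix_matrix_mult]
lemmas matrix_mult_diff_left = bounded_bilinear.diff_left [OF bounded_bilinear_matrix_matrix_mult]
lemmas matrix_mult_diff_right = bounded_bilinear.diff_right [OF bounded_bilinear_matrix_matrix_mult]
lemmas matrix_mult_scaleR_left = bounded_bilinear.scaleR_left [OF bounded_bilinear_matrix_matrix_mult]
lemmas matrix_mult_scaleR_right = bounded_bilinear.scaleR_right [OF bounded_bilinear_matrix_matrix_mult]
lemmas has_vector_derivative_matrix_mult =
  bounded_bilinear.has_vector_derivative [OF bounded_bilinear_matrix_matrix_mult]

lemmas matrix_ring_simps = matrix_add_ldistrib matrix_mult_add_left matrix_mult_minus_left
  matrix_mult_minus_right matrix_mult_diff_left matrix_mult_diff_right matrix_mult_scaleR_left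
  matrix_mult_scaleR_right matrix_mul_assoc

lemma bounded_bilinear_matrix_vector_mult:
  "bounded_bilinear ((*v) :: real^'n^'m \<Rightarrow> real^'n \<Rightarrow> real^'m)"
  unfolding bilinear_conv_bounded_bilinear [symmetric] bilinear_def
  by (auto intro!: linearI simp: algebra_simps scaleR_matrix_vector_assoc matrix_vector_mult_scaleR)

lemma bounded_linear_transpose: "bounded_linear (transpose :: real^'n^'m \<Rightarrow> real^'m^'n)"
  unfolding linear_conv_bounded_linear [symmetric]
  by (rule linearI) (auto simp: transpose_def vec_eq_iff)

lemma transpose_add: "transpose (A + B) = transpose A + transpose (B :: real^'n^'m)"
  by (rule linear_add [OF bounded_linear.linear [OF bounded_linear_transpose]])

lemma transpose_diff: "transpose (A - B) = transpose A - transpose (B :: real^'n^'m)"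
  by (rule linear_diff [OF bounded_linear.linear [OF bounded_linear_transpose]])

lemma transpose_uminus: "transpose (- B) = - transpose (B :: real^'n^'m)"
  by (rule linear_neg [OF bounded_linear.linear [OF bounded_linear_transpose]])

lemma transpose_zero [simp]: "transpose (0 :: real^'n^'m) = 0"
  by (rule linear_0 [OF bounded_linear.linear [OF bounded_linear_transpose]])

lemmas matrix_transpose_simps = transpose_add transpose_diff transpose_uminus transpose_scalar
  matrix_transpose_mul transpose_transpose

lemma has_vector_derivative_transpose:
  "(f has_vector_derivative f') F \<Longrightarrow>
    ((\<lambda>t. transpose (f t)) has_vector_derivative transpose f') F" for f' :: "real^'n^'m"
  by (rule bounded_linear.has_vector_derivative [OF bounded_linear_transpose])

section \<open>Congruence transformations and quadratic forms\<close>

lemma quadratic_form_congruence: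
  fixes X :: "real^'m^'m" and W :: "real^'n^'m"
  shows "v \<bullet> ((transpose W ** X ** W) *v v) = (W *v v) \<bullet> (X *v (W *v v))"
  by (metis dot_lmul_matrix inner_commute matrix_vector_mul_assoc transpose_matrix_vector)

lemma pos_semidef_congruence:
  fixes X :: "real^'m^'m" and W :: "real^'n^'m"
  assumes "pos_semidef X"
  shows "pos_semidef (transpose W ** X ** W)"
  using assms unfolding pos_semidef_def sym_mat_def
  by (simp add: quadratic_form_congruence matrix_transpose_simps matrix_mul_assoc)

section \<open>Block matrices indexed by sum types\<close>

lemma sum_UNIV_Plus:
  "(\<Sum>k\<in>(UNIV :: ('a::finite + 'b::finite) set). f k) = (\<Sum>a\<in>UNIV. f (Inl a)) + (\<Sum>b\<in>UNIV. f (Inr b))"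
  unfolding UNIV_Plus_UNIV [symmetric] by (subst sum.Plus) auto

lemma hcat_zero [simp]: "(0 ||| 0) = 0"
  and vcat_zero [simp]: "(0 === 0) = 0"
  by (auto simp: hcat_def vcat_def vec_eq_iff split: sum.splits)

text \<open>As rewrite rules, the last three equations bring mixed block matrices into the row-wise form of
  \<^const>\<open>Theta\<close>; two of them are needed because \<open>0 === 0\<close> collapses to \<open>0\<close>.\<close>

lemma block_algebra:
  fixes A A' :: "real^'a::finite^'m::finite" and B B' :: "real^'b::finite^'m"
    and C :: "real^'p::finite^'a" and D :: "real^'p^'b" and E :: "real^'m^'p"
    and F F' :: "real^'p^'m" and G G' :: "real^'p^'b"
    and H :: "real^'q::finite^'p" and K :: "real^'q^'m" and L :: "real^'q^'b"
  shows hcat_mult_vcat: "(A ||| B) ** (C === D) = A ** C + B ** D"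
    and mult_hcat: "E ** (A ||| B) = (E ** A ||| E ** B)"
    and vcat_mult: "(F === G) ** H = (F ** H === G ** H)"
    and transpose_hcat: "transpose (A ||| B) = (transpose A === transpose B)"
    and transpose_vcat: "transpose (C === D) = (transpose C ||| transpose D)"
    and hcat_add: "(A ||| B) + (A' ||| B') = (A + A' ||| B + B')"
    and vcat_add: "(F === G) + (F' === G') = (F + F' === G + G')"
    and hcat_uminus: "- (A ||| B) = (- A ||| - B)"
    and vcat_uminus: "- (F === G) = (- F === - G)"
    and vcat_hcat_vcat: "((F === G) ||| (K === L)) = (F ||| K === G ||| L)"
    and vcat_hcat_zero: "((F === G) ||| 0) = (F ||| 0 === G ||| 0)"
    and zero_hcat_vcat: "(0 ||| (F === G)) = (0 ||| F === 0 ||| G)"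
  by (auto simp: hcat_def vcat_def vec_eq_iff matrix_matrix_mult_def transpose_def sum_UNIV_Plus
      split: sum.splits)

section \<open>The matrix exponential\<close>

abbreviation matpow :: "real^'n^'n \<Rightarrow> nat \<Rightarrow> real^'n^'n" where
  "matpow M k \<equiv> ((**) M ^^ k) (mat 1)"

lemma matpow_commute: "matpow M k ** M = M ** matpow M k"
  by (induction k) (simp_all add: matrix_mul_assoc [symmetric])

lemma matpow_scaleR: "matpow (t *\<^sub>R M) k = t ^ k *\<^sub>R matpow M k"
  by (induction k) (simp_all add: matrix_ring_simps mult.commute)

lemma matpow_transpose: "matpow (transpose M) k = transpose (matpow M k)"
  by (induction k) (simp_all add: matrix_transpose_mul [symmetric] matpow_commute transpose_mat)

text \<open>The sum \<open>B\<close> of all absolute entries dominates every absolute row sum, so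
  each further factor \<open>M\<close> costs at most a factor \<open>B\<close>.\<close>

lemma matpow_component_bound:
  fixes M :: "real^'n^'n"
  defines "B \<equiv> \<Sum>i\<in>UNIV. \<Sum>j\<in>UNIV. \<bar>M $ i $ j\<bar>"
  shows "\<bar>matpow M k $ i $ j\<bar> \<le> B ^ k"
proof (induction k arbitrary: i)
  case 0
  then show ?case by (simp add: mat_def)
next
  case (Suc k)
  have "\<bar>matpow M (Suc k) $ i $ j\<bar> \<le> (\<Sum>l\<in>UNIV. \<bar>M $ i $ l\<bar> * \<bar>matpow M k $ l $ j\<bar>)"
    by (simp add: matrix_matrix_mult_def abs_mult [symmetric] sum_abs)
  also have "\<dots> \<le> (\<Sum>l\<in>UNIV. \<bar>M $ i $ l\<bar> * B ^ k)"
    by (intro sum_mono mult_left_mono Suc) auto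
  also have "\<dots> \<le> B * B ^ k"
    unfolding sum_distrib_right [symmetric]
  proof (intro mult_right_mono zero_le_power)
    show "(\<Sum>l\<in>UNIV. \<bar>M $ i $ l\<bar>) \<le> B"
      unfolding B_def by (rule member_le_sum [where f = "\<lambda>i. \<Sum>l\<in>UNIV. \<bar>M $ i $ l\<bar>"]) (auto intro: sum_nonneg)
    show "0 \<le> B" by (simp add: B_def sum_nonneg)
  qed
  finally show ?case by simp
qed

text \<open>Comparison with a scalar exponential series. Keeping \<open>t ^ k\<close> apart makes
  every entry a power series in \<open>t\<close> that converges everywhere, as termwise
  differentiation requires.\<close>

lemma summable_matpow_component:
  fixes M :: "real^'n^'n"
  shows "summable (\<lambda>k. (matpow M k $ i $ j / fact k) * t ^ k)"
proof (rule summable_comparison_test)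
  let ?B = "\<Sum>i\<in>UNIV. \<Sum>j\<in>UNIV. \<bar>M $ i $ j\<bar>"
  show "summable (\<lambda>k. inverse (fact k) * (?B * \<bar>t\<bar>) ^ k)"
    by (rule summable_exp)
  have "\<bar>matpow M k $ i $ j\<bar> / fact k * \<bar>t\<bar> ^ k \<le> ?B ^ k / fact k * \<bar>t\<bar> ^ k" for k
    by (intro mult_right_mono divide_right_mono matpow_component_bound) auto
  then show "\<exists>N. \<forall>k\<ge>N. norm (matpow M k $ i $ j / fact k * t ^ k) \<le> inverse (fact k) * (?B * \<bar>t\<bar>) ^ k"
    by (simp add: abs_mult power_abs field_simps power_mult_distrib)
qed

lemma mexp_sums: "(\<lambda>k. (1 / fact k) *\<^sub>R matpow M k) sums mexp M"
proof -
  \<comment> \<open>Convergence is checked entry by entry; the factor \<open>1 ^ k\<close> presents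
    the entries as the power series above at \<open>t = 1\<close>.\<close>
  have "(\<lambda>k. (1 / fact k) *\<^sub>R matpow M k) sums (\<chi> i j. \<Sum>k. matpow M k $ i $ j / fact k * 1 ^ k)"
    unfolding sums_def
  proof (intro vec_tendstoI)
    fix i j
    show "(\<lambda>n. (\<Sum>k<n. (1 / fact k) *\<^sub>R matpow M k) $ i $ j)
        \<longlonglongrightarrow> (\<chi> i j. \<Sum>k. matpow M k $ i $ j / fact k * 1 ^ k) $ i $ j"
      using summable_sums [OF summable_matpow_component [of M i j 1]]
      by (simp add: sums_def)
  qed
  then show ?thesis
    unfolding mexp_def by (simp only: sums_iff)
qed

lemma mexp_component: "mexp (t *\<^sub>R M) $ i $ j = (\<Sum>k. (matpow M k $ i $ j / fact k) * t ^ k)"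
  using sums_vec_nth [OF sums_vec_nth [OF mexp_sums [of "t *\<^sub>R M"]], of i j]
  by (simp add: sums_iff matpow_scaleR mult.commute)

lemma mexp_zero [simp]: "mexp (0 :: real^'n^'n) = mat 1"
  using mexp_component [of 0 "0 :: real^'n^'n"]
  by (simp add: vec_eq_iff powser_zero del: times_divide_eq_left)

lemma mexp_commute: "mexp (t *\<^sub>R M) ** M = M ** mexp (t *\<^sub>R M)"
proof -
  have "(\<lambda>k. ((1 / fact k) *\<^sub>R matpow (t *\<^sub>R M) k) ** M) sums (mexp (t *\<^sub>R M) ** M)"
    by (rule bounded_linear.sums [OF bounded_bilinear.bounded_linear_left
          [OF bounded_bilinear_matrix_matrix_mult] mexp_sums])
  moreover have "(\<lambda>k. M ** ((1 / fact k) *\<^sub>R matpow (t *\<^sub>R M) k)) sums (M ** mexp (t *\<^sub>R M))"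
    by (rule bounded_linear.sums [OF bounded_bilinear.bounded_linear_right
          [OF bounded_bilinear_matrix_matrix_mult] mexp_sums])
  ultimately show ?thesis
    by (simp add: matpow_scaleR matpow_commute matrix_mult_scaleR_left matrix_mult_scaleR_right
        sums_iff)
qed

lemma mexp_transpose: "mexp (t *\<^sub>R transpose M) = transpose (mexp (t *\<^sub>R M))"
proof -
  have "(\<lambda>k. transpose ((1 / fact k) *\<^sub>R matpow (t *\<^sub>R M) k)) sums transpose (mexp (t *\<^sub>R M))"
    by (rule bounded_linear.sums [OF bounded_linear_transpose mexp_sums])
  then have "(\<lambda>k. (1 / fact k) *\<^sub>R matpow (t *\<^sub>R transpose M) k) sums transpose (mexp (t *\<^sub>R M))"
    by (simp add: transpose_scalar matpow_scaleR matpow_transpose)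
  then show ?thesis
    using mexp_sums sums_unique2 by blast
qed

section \<open>Derivative and inverse of the exponential\<close>

lemma has_vector_derivative_mexp:
  "((\<lambda>t. mexp (t *\<^sub>R M)) has_vector_derivative M ** mexp (t *\<^sub>R M)) (at t within S)"
proof -
  have "((\<lambda>t. mexp (t *\<^sub>R M) $ i $ j) has_real_derivative (M ** mexp (t *\<^sub>R M)) $ i $ j) (at t)" for i j
  proof -
    define c where "c k = matpow M k $ i $ j / fact k" for k
    \<comment> \<open>The differentiated series has coefficient \<open>(k + 1) * c (k + 1)\<close>.
      The factorial absorbs \<open>k + 1\<close>, and one factor \<open>M\<close> splits off the
      power.\<close>
    have "diffs c k = (\<Sum>l\<in>UNIV. M $ i $ l * (matpow M k $ l $ j / fact k))" for k
      by (simp add: diffs_def c_def field_simps matrix_matrix_mult_def sum_divide_distrib sum_distrib_left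
          del: of_nat_Suc)
    then have "(\<Sum>k. diffs c k * t ^ k)
        = (\<Sum>k. \<Sum>l\<in>UNIV. M $ i $ l * (matpow M k $ l $ j / fact k * t ^ k))"
      by (simp add: sum_distrib_right mult.assoc)
    also have "\<dots> = (\<Sum>l\<in>UNIV. \<Sum>k. M $ i $ l * (matpow M k $ l $ j / fact k * t ^ k))"
      by (intro suminf_sum summable_mult summable_matpow_component)
    also have "\<dots> = (M ** mexp (t *\<^sub>R M)) $ i $ j"
      by (simp add: matrix_matrix_mult_def mexp_component suminf_mult summable_matpow_component
          del: times_divide_eq_left times_divide_eq_right)
    finally show ?thesis
      using termdiffs_strong_converges_everywhere [of c t] summable_matpow_component [of M i j]
      by (simp add: c_def mexp_component)
  qed
  note component = this
  have "((\<lambda>t. mexp (t *\<^sub>R M)) has_derivative (\<lambda>h. h *\<^sub>R (M ** mexp (t *\<^sub>R M)))) (at t)"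
  proof (rule has_derivative_componentwise_within [THEN iffD2], rule)
    fix b :: "real^'a^'a" assume "b \<in> Basis"
    then obtain i j where b: "b = axis i (axis j 1)"
      by (auto simp: Basis_vec_def)
    show "((\<lambda>t. mexp (t *\<^sub>R M) \<bullet> b) has_derivative (\<lambda>h. h *\<^sub>R (M ** mexp (t *\<^sub>R M)) \<bullet> b)) (at t)"
      using component [of i j] by (simp add: b inner_axis has_field_derivative_def mult_commute_abs)
  qed
  then show ?thesis
    unfolding has_vector_derivative_def by (rule has_derivative_at_withinI)
qed

text \<open>Chain rule for the two shifts that occur: \<open>b = -1\<close> for the time remaining
  to \<theta>, \<open>b = 1\<close> for the time elapsed since an impulse.\<close>

lemma has_vector_derivative_mexp_affine:
  "((\<lambda>t. mexp ((a + b * t) *\<^sub>R M)) has_vector_derivative b *\<^sub>R (M ** mexp ((a + b * t) *\<^sub>R M)))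
     (at t within S)"
proof -
  have "((\<lambda>t. a + b * t) has_vector_derivative b) (at t within S)"
    by (auto intro!: derivative_eq_intros)
  then show ?thesis
    using vector_diff_chain_within [OF _ has_vector_derivative_mexp] by (fastforce simp: o_def)
qed

text \<open>The product has derivative 0 because \<open>M\<close> commutes with its exponential, so
  it keeps its value at 0, the identity.\<close>

lemma mexp_uminus_inverse: "mexp (t *\<^sub>R M) ** mexp (- t *\<^sub>R M) = mat 1"
proof -
  have "((\<lambda>t. mexp (t *\<^sub>R M) ** mexp (- t *\<^sub>R M)) has_vector_derivative 0) (at t)" for t
    using has_vector_derivative_matrix_mult [OF has_vector_derivative_mexp [of M t]
        has_vector_derivative_mexp_affine [of 0 "-1" M t]]
    by (simp add: matrix_ring_simps mexp_commute del: scaleR_minus_left)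
  then have "mexp (t *\<^sub>R M) ** mexp (- t *\<^sub>R M) = mexp (0 *\<^sub>R M) ** mexp (- 0 *\<^sub>R M)"
    unfolding has_vector_derivative_def
    by (intro has_derivative_zero_unique [of UNIV]) auto
  then show ?thesis by simp
qed

section \<open>Uniform bounds over compact parameter sets\<close>

text \<open>The quadratic form attains its minimum on the compact set
  \<open>K \<times> sphere 0 1\<close>; the minimum is positive and serves as \<epsilon>. A
  singleton \<open>K\<close> gives the bound for one constant matrix.\<close>

lemma pos_def_uniform_bound:
  fixes f :: "'k::metric_space \<Rightarrow> real^'n^'n"
  assumes "compact K" and cont: "continuous_on K f" and pos: "\<And>k. k \<in> K \<Longrightarrow> pos_def (f k)"
  obtains \<epsilon> where "\<epsilon> > 0" and "\<And>k v. k \<in> K \<Longrightarrow> \<epsilon> * (v \<bullet> v) \<le> v \<bullet> (f k *v v)"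
proof (cases "K = {}")
  case True
  then show ?thesis using that [of 1] by simp
next
  case False
  let ?q = "\<lambda>(k, v). v \<bullet> (f k *v v)"
  have "continuous_on (K \<times> sphere 0 1) ?q"
    unfolding case_prod_unfold
    by (intro continuous_on_inner continuous_on_snd continuous_on_id
        bounded_bilinear.continuous_on [OF bounded_bilinear_matrix_vector_mult]
        continuous_on_compose2 [OF cont continuous_on_fst [OF continuous_on_id]]) auto
  moreover have "compact (K \<times> sphere (0 :: real^'n) 1)"
    using \<open>compact K\<close> by (intro compact_Times compact_sphere)
  moreover have "sphere (0 :: real^'n) 1 \<noteq> {}"
    by simp
  ultimately obtain k0 v0 where min: "k0 \<in> K" "v0 \<in> sphere 0 1"
    "\<And>k v. k \<in> K \<Longrightarrow> v \<in> sphere 0 1 \<Longrightarrow> v0 \<bullet> (f k0 *v v0) \<le> v \<bullet> (f k *v v)"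
    using continuous_attains_inf [of "K \<times> sphere (0 :: real^'n) 1" ?q] False by force
  show ?thesis
  proof
    show "v0 \<bullet> (f k0 *v v0) > 0"
    proof -
      have "v0 \<noteq> 0" using min(2) by auto
      then show ?thesis using pos [OF min(1)] by (simp add: pos_def_def)
    qed
    fix k and v :: "real^'n" assume "k \<in> K"
    show "v0 \<bullet> (f k0 *v v0) * (v \<bullet> v) \<le> v \<bullet> (f k *v v)"
    proof (cases "v = 0")
      case False
      \<comment> \<open>Both sides are homogeneous of degree 2 in \<open>v\<close>, so comparing on
        the unit sphere is enough.\<close>
      have "v0 \<bullet> (f k0 *v v0) \<le> (v /\<^sub>R norm v) \<bullet> (f k *v (v /\<^sub>R norm v))"
        using False \<open>k \<in> K\<close> by (intro min) auto
      also have "\<dots> = (v \<bullet> (f k *v v)) / (v \<bullet> v)"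
        using False by (simp add: matrix_vector_mult_scaleR dot_square_norm power2_eq_square field_simps)
      finally show ?thesis
        using False by (simp add: field_simps)
    qed simp
  qed
qed

lemma matrix_vector_bound_compact:
  fixes f :: "'k::metric_space \<Rightarrow> real^'n^'m"
  assumes "compact K" and "continuous_on K f"
  obtains C where "C > 0" and "\<And>k v. k \<in> K \<Longrightarrow> norm (f k *v v) \<le> C * norm v"
proof -
  obtain b where b: "b > 0" "\<And>k. k \<in> K \<Longrightarrow> norm (f k) \<le> b"
    using compact_imp_bounded [OF compact_continuous_image [OF assms(2,1)]]
    by (auto simp: bounded_pos)
  obtain c where c: "c > 0" "\<And>(M :: real^'n^'m) v. norm (M *v v) \<le> norm M * norm v * c"
    using bounded_bilinear.pos_bounded [OF bounded_bilinear_matrix_vector_mult] by blast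
  show ?thesis
  proof
    show "b * c > 0" using b c by simp
    fix k v assume "k \<in> K"
    have "norm (f k *v v) \<le> norm (f k) * norm v * c" by (rule c)
    also have "\<dots> \<le> b * norm v * c"
      using b(2) [OF \<open>k \<in> K\<close>] c(1) by (intro mult_right_mono) auto
    finally show "norm (f k *v v) \<le> b * c * norm v" by (simp add: mult_ac)
  qed
qed

lemma continuous_on_mexp: "continuous_on S (\<lambda>t. mexp (t *\<^sub>R M))"
  unfolding continuous_on_eq_continuous_within
  using has_vector_derivative_continuous [OF has_vector_derivative_mexp] by blast

section \<open>Equivalence of the two conditions\<close>

text \<open>With \<open>Q(s) = \<Phi>(s)\<^sup>TP\<Phi>(s)\<close>, the first block \<open>\<theta>(Q(\<theta> - \<tau>) - P)\<close> turns the first block of the matrix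
  inequality into an equality and vanishes at \<open>\<tau> = \<theta>\<close>; the second block \<open>\<tau>J\<^sup>T(Q(\<theta>) - P)J\<close> is linear in \<open>\<tau>\<close>,
  vanishes at \<open>\<tau> = 0\<close>, and equals \<open>J\<^sup>T\<close> (first block at \<open>\<tau> = 0\<close>) \<open>J\<close> at \<open>\<tau> = \<theta>\<close>, as the boundary condition
  demands.\<close>

definition looped_Z ::
  "real^'n^'n \<Rightarrow> real^'n^'n \<Rightarrow> real^'n^'n \<Rightarrow> real \<Rightarrow> real \<Rightarrow> real^('n + 'n + 'n)^('n + 'n + 'n)" where
  "looped_Z A J P \<tau> \<theta> =
     (\<theta> *\<^sub>R (transpose (mexp ((\<theta> - \<tau>) *\<^sub>R A)) ** P ** mexp ((\<theta> - \<tau>) *\<^sub>R A) - P) ||| 0 ||| 0 ===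
      0 ||| \<tau> *\<^sub>R (transpose J ** (transpose (mexp (\<theta> *\<^sub>R A)) ** P ** mexp (\<theta> *\<^sub>R A) - P) ** J) ||| 0 ===
      0 ||| 0 ||| 0)"

text \<open>The block diagonal matrix is a sum of congruences of \<open>X\<close> and
  \<open>Y\<close> by constant selector matrices, hence bounded linear in each of them.\<close>

lemma has_vector_derivative_block_diag:
  fixes X :: "real \<Rightarrow> real^'n^'n" and Y :: "real \<Rightarrow> real^'n^'n"
  assumes X: "(X has_vector_derivative X') F" and Y: "(Y has_vector_derivative Y') F"
  shows "((\<lambda>t. (X t ||| 0 ||| 0 === 0 ||| Y t ||| 0 === 0 ||| 0 ||| 0) :: real^('n + 'n + 'n)^('n + 'n + 'n))
    has_vector_derivative (X' ||| 0 ||| 0 === 0 ||| Y' ||| 0 === 0 ||| 0 ||| 0)) F"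
proof -
  let ?E1 = "mat 1 ||| 0 ||| 0 :: real^('n + 'n + 'n)^'n" and ?E2 = "0 ||| mat 1 ||| 0 :: real^('n + 'n + 'n)^'n"
  have eq: "(X ||| 0 ||| 0 === 0 ||| Y ||| 0 === 0 ||| 0 ||| 0)
      = transpose ?E1 ** X ** ?E1 + transpose ?E2 ** Y ** ?E2" for X Y :: "real^'n^'n"
    by (simp add: block_algebra transpose_mat)
  have *: "bounded_linear (\<lambda>X. transpose E ** X ** E)" for E :: "real^('n + 'n + 'n)^'n"
    by (intro bounded_linear_compose [OF bounded_bilinear.bounded_linear_left
        [OF bounded_bilinear_matrix_matrix_mult]] bounded_bilinear.bounded_linear_right
        [OF bounded_bilinear_matrix_matrix_mult])
  show ?thesis
    unfolding eq
    by (intro has_vector_derivative_add bounded_linear.has_vector_derivative [OF *] X Y)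
qed

lemma has_vector_derivative_looped_Z:
  fixes A J P :: "real^'n^'n"
  defines "\<Psi> \<equiv> \<lambda>\<tau> \<theta>. mexp ((\<theta> - \<tau>) *\<^sub>R A)"
  shows "((\<lambda>\<tau>. looped_Z A J P \<tau> \<theta>) has_vector_derivative
     (- \<theta> *\<^sub>R (transpose (\<Psi> \<tau> \<theta>) ** P ** \<Psi> \<tau> \<theta> ** A + transpose A ** transpose (\<Psi> \<tau> \<theta>) ** P ** \<Psi> \<tau> \<theta>) ||| 0 ||| 0 ===
      0 ||| transpose J ** (transpose (mexp (\<theta> *\<^sub>R A)) ** P ** mexp (\<theta> *\<^sub>R A) - P) ** J ||| 0 ===
      0 ||| 0 ||| 0)) (at \<tau> within S)"
proof -
  \<comment> \<open>The sign comes from \<theta> - \<tau>; commutation puts \<open>A\<close> on the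
    right, the position it has in the matrix inequality.\<close>
  have \<Psi>: "((\<lambda>\<tau>. \<Psi> \<tau> \<theta>) has_vector_derivative - (\<Psi> \<tau> \<theta> ** A)) (at \<tau> within S)"
    using has_vector_derivative_mexp_affine [of \<theta> "-1" A \<tau> S] by (simp add: \<Psi>_def mexp_commute)
  have "((\<lambda>\<tau>. \<theta> *\<^sub>R (transpose (\<Psi> \<tau> \<theta>) ** P ** \<Psi> \<tau> \<theta> - P)) has_vector_derivative
      \<theta> *\<^sub>R ((transpose (\<Psi> \<tau> \<theta>) ** P ** (- (\<Psi> \<tau> \<theta> ** A))
        + (transpose (\<Psi> \<tau> \<theta>) ** 0 + transpose (- (\<Psi> \<tau> \<theta> ** A)) ** P) ** \<Psi> \<tau> \<theta>) - 0)) (at \<tau> within S)"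
    by (intro bounded_linear.has_vector_derivative [OF bounded_linear_scaleR_right]
        has_vector_derivative_diff has_vector_derivative_matrix_mult has_vector_derivative_transpose
        has_vector_derivative_const \<Psi>)
  also have "\<theta> *\<^sub>R ((transpose (\<Psi> \<tau> \<theta>) ** P ** (- (\<Psi> \<tau> \<theta> ** A))
        + (transpose (\<Psi> \<tau> \<theta>) ** 0 + transpose (- (\<Psi> \<tau> \<theta> ** A)) ** P) ** \<Psi> \<tau> \<theta>) - 0)
      = - \<theta> *\<^sub>R (transpose (\<Psi> \<tau> \<theta>) ** P ** \<Psi> \<tau> \<theta> ** A + transpose A ** transpose (\<Psi> \<tau> \<theta>) ** P ** \<Psi> \<tau> \<theta>)"
    by (simp add: matrix_ring_simps matrix_transpose_simps algebra_simps)
  finally have first: "((\<lambda>\<tau>. \<theta> *\<^sub>R (transpose (\<Psi> \<tau> \<theta>) ** P ** \<Psi> \<tau> \<theta> - P)) has_vector_derivative \<dots>)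
      (at \<tau> within S)" .
  have second: "((\<lambda>\<tau>. \<tau> *\<^sub>R N) has_vector_derivative N) (at \<tau> within S)" for N :: "real^'n^'n"
    by (auto intro!: derivative_eq_intros)
  show ?thesis
    unfolding looped_Z_def
    by (intro has_vector_derivative_block_diag second first [unfolded \<Psi>_def] | unfold \<Psi>_def)+
qed

text \<open>With \<open>looped_Z\<close> all blocks of the matrix inequality vanish except the
  middle one, which is the inequality of (a) shifted by its uniform margin \<epsilon>.\<close>

lemma discrete_time_imp_looped_functional:
  fixes A J :: "real^'n^'n"
  assumes "0 < Tmin" and "Tmin \<le> Tmax" and "discrete_time_condition A J Tmin Tmax"
  shows "looped_functional_condition A J Tmin Tmax"
proof -
  define Q where "Q P \<theta> = transpose (mexp (\<theta> *\<^sub>R A)) ** P ** mexp (\<theta> *\<^sub>R A)" for P \<theta>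
  obtain P where P: "pos_def P"
    and neg: "\<And>\<theta>. \<theta> \<in> {Tmin..Tmax} \<Longrightarrow> pos_def (P - transpose J ** Q P \<theta> ** J)"
    using assms(3) unfolding discrete_time_condition_def Q_def
    by (auto simp: mexp_transpose matrix_mul_assoc)
  have P_sym [simp]: "transpose P = P"
    using P by (simp add: pos_def_def sym_mat_def)
  have Q_sym [simp]: "transpose (Q P \<theta>) = Q P \<theta>" for \<theta>
    by (simp add: Q_def matrix_transpose_simps matrix_mul_assoc)
  have "continuous_on {Tmin..Tmax} (\<lambda>\<theta>. P - transpose J ** Q P \<theta> ** J)"
    unfolding Q_def
    by (intro continuous_on_diff bounded_bilinear.continuous_on [OF bounded_bilinear_matrix_matrix_mult]
        bounded_linear.continuous_on [OF bounded_linear_transpose] continuous_on_mexp continuous_on_const)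
  then obtain \<epsilon> where "\<epsilon> > 0"
    and \<epsilon>: "\<And>\<theta> v. \<theta> \<in> {Tmin..Tmax} \<Longrightarrow> \<epsilon> * (v \<bullet> v) \<le> v \<bullet> ((P - transpose J ** Q P \<theta> ** J) *v v)"
    using pos_def_uniform_bound [of "{Tmin..Tmax}" "\<lambda>\<theta>. P - transpose J ** Q P \<theta> ** J"] neg
    by (metis compact_Icc)
  have psd: "pos_semidef (P - transpose J ** Q P \<theta> ** J - \<epsilon> *\<^sub>R mat 1)" if "\<theta> \<in> {Tmin..Tmax}" for \<theta>
    using \<epsilon> [OF that] unfolding pos_semidef_def sym_mat_def
    by (simp add: matrix_transpose_simps matrix_mul_assoc transpose_mat algebra_simps
        scaleR_matrix_vector_assoc [symmetric])
  show ?thesis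
    unfolding looped_functional_condition_def
  proof (intro exI [of _ P] exI [of _ \<epsilon>] exI [of _ "looped_Z A J P"] conjI ballI P \<open>\<epsilon> > 0\<close>)
    fix \<tau> \<theta> assume \<tau>: "\<tau> \<in> {0..Tmax}"
    show "sym_mat (looped_Z A J P \<tau> \<theta>)"
      unfolding looped_Z_def sym_mat_def
      by (simp add: block_algebra matrix_transpose_simps matrix_mul_assoc)
    show "(\<lambda>s. looped_Z A J P s \<theta>) differentiable at \<tau> within {0..Tmax}"
      using has_vector_derivative_looped_Z differentiableI_vector by blast
  next
    fix \<theta> assume "\<theta> \<in> {Tmin..Tmax}"
    show "transpose Y2 ** looped_Z A J P \<theta> \<theta> ** Y2 - transpose (Y1 J) ** looped_Z A J P 0 \<theta> ** Y1 J = 0"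
      by (simp add: looped_Z_def Y1_def Y2_def block_algebra transpose_mat matrix_ring_simps)
  next
    fix \<theta> \<tau> assume \<theta>: "\<theta> \<in> {Tmin..Tmax}" and \<tau>: "\<tau> \<in> {0..\<theta>}"
    let ?E = "0 ||| mat 1 ||| 0 :: real^('n + 'n + 'n)^'n"
    \<comment> \<open>As 0 < \<open>Tmax\<close>, the interval is nondegenerate, so the derivative
      within it is unique, also at its end points.\<close>
    have "vector_derivative (\<lambda>s. looped_Z A J P s \<theta>) (at \<tau> within {0..Tmax}) =
     (- \<theta> *\<^sub>R (Q P (\<theta> - \<tau>) ** A + transpose A ** Q P (\<theta> - \<tau>)) ||| 0 ||| 0 ===
      0 ||| transpose J ** (Q P \<theta> - P) ** J ||| 0 ===
      0 ||| 0 ||| 0)"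
      unfolding Q_def using \<theta> \<tau> assms
      by (intro vector_derivative_within_closed_interval)
        (use has_vector_derivative_looped_Z [of A J P \<theta> \<tau>] in \<open>auto simp: matrix_mul_assoc\<close>)
    \<comment> \<open>In the first block the \<open>P\<close> terms of \<open>Theta\<close> and
      \<open>He\<close> cancel, and so do the \<open>Q P (\<theta> - \<tau>)\<close> terms of
      \<open>He\<close> and the derivative. In the middle block \<open>transpose J ** P ** J\<close>
      cancels.\<close>
    then have eq: "0 - (Theta A J P \<epsilon> \<theta> + He (looped_Z A J P \<tau> \<theta> ** A_aug A)
        + vector_derivative (\<lambda>s. looped_Z A J P s \<theta>) (at \<tau> within {0..Tmax}))
      = (0 ||| 0 ||| 0 === 0 ||| P - transpose J ** Q P \<theta> ** J - \<epsilon> *\<^sub>R mat 1 ||| 0 === 0 ||| 0 ||| 0)"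
      unfolding Theta_def He_def A_aug_def looped_Z_def Q_def [symmetric]
      by (simp add: block_algebra matrix_ring_simps matrix_transpose_simps algebra_simps)
    have "transpose ?E ** X ** ?E = (0 ||| 0 ||| 0 === 0 ||| X ||| 0 === 0 ||| 0 ||| 0)" for X
      by (simp add: block_algebra transpose_mat)
    then show "Theta A J P \<epsilon> \<theta> + He (looped_Z A J P \<tau> \<theta> ** A_aug A)
        + vector_derivative (\<lambda>s. looped_Z A J P s \<theta>) (at \<tau> within {0..Tmax}) \<preceq>\<^sub>L 0"
      using pos_semidef_congruence [OF psd [OF \<theta>], of ?E] unfolding eq by simp
  qed
qed

text \<open>Congruence by \<open>W \<tau>\<close> turns the left-hand side of the matrix inequality
  into the derivative of \<open>G\<close>. Working with the matrix \<open>G\<close> leaves the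
  vector to be chosen only when signs are compared.\<close>

lemma looped_functional_imp_discrete_time:
  fixes A J :: "real^'n^'n"
  assumes "0 < Tmin" and "Tmin \<le> Tmax" and "looped_functional_condition A J Tmin Tmax"
  shows "discrete_time_condition A J Tmin Tmax"
proof -
  obtain P \<epsilon> and Z :: "real \<Rightarrow> real \<Rightarrow> real^('n + 'n + 'n)^('n + 'n + 'n)"
    where P: "pos_def P" and "\<epsilon> > 0"
    and Z: "\<And>\<tau> \<theta>. \<tau> \<in> {0..Tmax} \<Longrightarrow> \<theta> \<in> {Tmin..Tmax} \<Longrightarrow>
      sym_mat (Z \<tau> \<theta>) \<and> (\<lambda>s. Z s \<theta>) differentiable (at \<tau> within {0..Tmax})"
    and loop: "\<And>\<theta>. \<theta> \<in> {Tmin..Tmax} \<Longrightarrow>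
      transpose Y2 ** Z \<theta> \<theta> ** Y2 - transpose (Y1 J) ** Z 0 \<theta> ** Y1 J = 0"
    and lmi: "\<And>\<theta> \<tau>. \<theta> \<in> {Tmin..Tmax} \<Longrightarrow> \<tau> \<in> {0..\<theta>} \<Longrightarrow>
      Theta A J P \<epsilon> \<theta> + He (Z \<tau> \<theta> ** A_aug A)
        + vector_derivative (\<lambda>s. Z s \<theta>) (at \<tau> within {0..Tmax}) \<preceq>\<^sub>L 0"
    using assms(3) unfolding looped_functional_condition_def by blast
  have P_sym: "transpose P = P"
    using P by (simp add: pos_def_def sym_mat_def)
  have "pos_def (P - transpose J ** transpose (mexp (\<theta> *\<^sub>R A)) ** P ** mexp (\<theta> *\<^sub>R A) ** J)"
    if \<theta>: "\<theta> \<in> {Tmin..Tmax}" for \<theta>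
  proof -
    define \<Phi> where "\<Phi> \<tau> = mexp (\<tau> *\<^sub>R A) ** J" for \<tau>
    define M where "M = \<epsilon> *\<^sub>R mat 1 + transpose J ** P ** J - P"
    define W :: "real \<Rightarrow> real^'n^('n + 'n + 'n)" where "W \<tau> = (\<Phi> \<tau> === mat 1 === \<Phi> \<theta>)" for \<tau>
    define G where "G \<tau> = transpose (W \<tau>) ** Z \<tau> \<theta> ** W \<tau>
      + \<theta> *\<^sub>R (transpose (\<Phi> \<tau>) ** P ** \<Phi> \<tau>) + \<tau> *\<^sub>R M" for \<tau>
    define Z' where "Z' \<tau> = vector_derivative (\<lambda>s. Z s \<theta>) (at \<tau> within {0..Tmax})" for \<tau>
    define R where "R \<tau> = Theta A J P \<epsilon> \<theta> + He (Z \<tau> \<theta> ** A_aug A) + Z' \<tau>" for \<tau>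
    have G': "(G has_vector_derivative transpose (W \<tau>) ** R \<tau> ** W \<tau>) (at \<tau> within {0..Tmax})"
      if \<tau>: "\<tau> \<in> {0..Tmax}" for \<tau>
    proof -
      have dZ: "((\<lambda>s. Z s \<theta>) has_vector_derivative Z' \<tau>) (at \<tau> within {0..Tmax})"
        using Z [OF \<tau> \<theta>] vector_derivative_works unfolding Z'_def by blast
      have sZ: "transpose (Z \<tau> \<theta>) = Z \<tau> \<theta>"
        using Z [OF \<tau> \<theta>] by (simp add: sym_mat_def)
      have d\<Phi>: "(\<Phi> has_vector_derivative A ** \<Phi> \<tau>) (at \<tau> within {0..Tmax})"
        unfolding \<Phi>_def
        using has_vector_derivative_matrix_mult [OF has_vector_derivative_mexp has_vector_derivative_const]
        by (fastforce simp: matrix_mul_assoc)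
      \<comment> \<open>Only the first block depends on \<tau>. It solves the linear equation, so
        \<open>A_aug A\<close> acts on \<open>W\<close> as differentiation.\<close>
      have W: "W = (\<lambda>s. (mat 1 === 0 === 0) ** \<Phi> s + (0 === mat 1 === \<Phi> \<theta>))"
        by (simp add: W_def block_algebra fun_eq_iff)
      have A_W: "A_aug A ** W \<tau> = (mat 1 === 0 === 0) ** (A ** \<Phi> \<tau>)"
        unfolding A_aug_def W_def by (simp add: block_algebra)
      have dW: "(W has_vector_derivative A_aug A ** W \<tau>) (at \<tau> within {0..Tmax})"
        unfolding A_W unfolding W
        using has_vector_derivative_add [OF has_vector_derivative_matrix_mult
            [OF has_vector_derivative_const d\<Phi>] has_vector_derivative_const]
        by fastforce
      have "(G has_vector_derivative
          (transpose (W \<tau>) ** Z \<tau> \<theta> ** (A_aug A ** W \<tau>)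
            + (transpose (W \<tau>) ** Z' \<tau> + transpose (A_aug A ** W \<tau>) ** Z \<tau> \<theta>) ** W \<tau>)
          + \<theta> *\<^sub>R (transpose (\<Phi> \<tau>) ** P ** (A ** \<Phi> \<tau>)
            + (transpose (\<Phi> \<tau>) ** 0 + transpose (A ** \<Phi> \<tau>) ** P) ** \<Phi> \<tau>)
          + (\<tau> *\<^sub>R 0 + 1 *\<^sub>R M)) (at \<tau> within {0..Tmax})"
        unfolding G_def
        by (intro bounded_linear.has_vector_derivative [OF bounded_linear_scaleR_right]
            has_vector_derivative_add has_vector_derivative_matrix_mult has_vector_derivative_transpose
            has_vector_derivative_scaleR has_vector_derivative_const DERIV_ident dW dZ d\<Phi>)
      \<comment> \<open>The two terms are exactly the derivatives of the last two summands of
        \<open>G\<close>, up to the symmetry of \<open>P\<close>.\<close>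
      moreover have "transpose (W \<tau>) ** Theta A J P \<epsilon> \<theta> ** W \<tau> = \<theta> *\<^sub>R (transpose (\<Phi> \<tau>) ** He (P ** A) ** \<Phi> \<tau>) + M"
        unfolding W_def Theta_def M_def [symmetric]
        by (simp add: block_algebra transpose_mat matrix_ring_simps)
      ultimately show ?thesis
        by (simp add: R_def He_def matrix_ring_simps matrix_transpose_simps sZ P_sym algebra_simps)
    qed
    have nonincreasing: "v \<bullet> (G \<theta> *v v) \<le> v \<bullet> (G 0 *v v)" for v
    proof -
      let ?g = "\<lambda>\<tau>. v \<bullet> (G \<tau> *v v)"
      have g': "(?g has_vector_derivative v \<bullet> ((transpose (W \<tau>) ** R \<tau> ** W \<tau>) *v v)) (at \<tau> within {0..Tmax})"
        if "\<tau> \<in> {0..Tmax}" for \<tau>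
        by (intro bounded_linear.has_vector_derivative [OF bounded_linear_inner_right]
            bounded_linear.has_vector_derivative [OF bounded_bilinear.bounded_linear_left
              [OF bounded_bilinear_matrix_vector_mult]] G' that)
      \<comment> \<open>Only interior derivatives are needed: there the derivative within
        \<open>{0..Tmax}\<close> is two-sided, and continuity covers the end points.\<close>
      show ?thesis
      proof (rule DERIV_nonpos_imp_decreasing_open [where f = ?g and a = 0 and b = \<theta>])
        show "0 \<le> \<theta>" using \<theta> assms by simp
        have "continuous_on {0..Tmax} ?g"
          unfolding continuous_on_eq_continuous_within
          using has_vector_derivative_continuous [OF g'] by blast
        then show "continuous_on {0..\<theta>} ?g"
          by (rule continuous_on_subset) (use \<theta> in auto)
        fix \<tau> assume \<tau>: "0 < \<tau>" "\<tau> < \<theta>"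
        have "(?g has_vector_derivative v \<bullet> ((transpose (W \<tau>) ** R \<tau> ** W \<tau>) *v v)) (at \<tau>)"
          using g' [of \<tau>] \<tau> \<theta> by (simp add: at_within_Icc_at)
        moreover have "pos_semidef (0 - R \<tau>)"
          using lmi [OF \<theta>, of \<tau>] \<tau> by (simp only: R_def Z'_def) simp
        then have "0 \<le> (W \<tau> *v v) \<bullet> ((0 - R \<tau>) *v (W \<tau> *v v))"
          by (simp only: pos_semidef_def)
        then have "v \<bullet> ((transpose (W \<tau>) ** R \<tau> ** W \<tau>) *v v) \<le> 0"
          unfolding quadratic_form_congruence 
            by (simp add: matrix_vector_mult_diff_rdistrib inner_diff_right del: diff_0)
        ultimately show "\<exists>y. DERIV ?g \<tau> :> y \<and> y \<le> 0"
          by (auto simp: has_real_derivative_iff_has_vector_derivative)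
      qed
    qed
    \<comment> \<open>Both ends factor through the same matrix, since \<open>\<Phi> 0 = J\<close>.
      The boundary condition therefore equates the two values of the \<open>Z\<close> term.\<close>
    have "W \<theta> = Y2 ** (mat 1 === \<Phi> \<theta>)" "W 0 = Y1 J ** (mat 1 === \<Phi> \<theta>)"
      by (simp_all add: W_def Y1_def Y2_def \<Phi>_def block_algebra)
    then have "transpose (W \<theta>) ** Z \<theta> \<theta> ** W \<theta> - transpose (W 0) ** Z 0 \<theta> ** W 0
      = transpose (mat 1 === \<Phi> \<theta>) ** (transpose Y2 ** Z \<theta> \<theta> ** Y2 - transpose (Y1 J) ** Z 0 \<theta> ** Y1 J) ** (mat 1 === \<Phi> \<theta>)"
      by (simp add: matrix_ring_simps matrix_transpose_mul)
    then have Z_cancel: "transpose (W \<theta>) ** Z \<theta> \<theta> ** W \<theta> = transpose (W 0) ** Z 0 \<theta> ** W 0"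
      using loop [OF \<theta>] by simp
    \<comment> \<open>The increment of the \<open>P\<close> term contributes
      \<open>- transpose J ** P ** J\<close> at \<tau> = 0, which cancels against the same term in
      \<open>M\<close>; what remains carries the common factor \<theta>.\<close>
    have G_diff: "G \<theta> - G 0 = \<theta> *\<^sub>R (\<epsilon> *\<^sub>R mat 1 - (P - transpose (\<Phi> \<theta>) ** P ** \<Phi> \<theta>))"
      unfolding G_def Z_cancel by (simp add: M_def \<Phi>_def algebra_simps)
    have "0 < v \<bullet> ((P - transpose (\<Phi> \<theta>) ** P ** \<Phi> \<theta>) *v v)" if "v \<noteq> 0" for v
    proof -
      have "v \<bullet> ((G \<theta> - G 0) *v v) \<le> 0"
        using nonincreasing [of v] by (simp add: algebra_simps)
      then have "\<theta> * (\<epsilon> * (v \<bullet> v) - v \<bullet> ((P - transpose (\<Phi> \<theta>) ** P ** \<Phi> \<theta>) *v v)) \<le> 0"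
        unfolding G_diff by (simp add: algebra_simps flip: scaleR_matrix_vector_assoc)
      then have "\<epsilon> * (v \<bullet> v) \<le> v \<bullet> ((P - transpose (\<Phi> \<theta>) ** P ** \<Phi> \<theta>) *v v)"
        using \<theta> assms(1) by (simp add: mult_le_0_iff)
      moreover have "\<epsilon> * (v \<bullet> v) > 0"
        using that \<open>\<epsilon> > 0\<close> by simp
      ultimately show ?thesis by linarith
    qed
    then show ?thesis
      unfolding pos_def_def sym_mat_def \<Phi>_def
      by (simp add: matrix_transpose_simps matrix_mul_assoc P_sym)
  qed
  then show ?thesis
    unfolding discrete_time_condition_def using P
    by (auto simp: mexp_transpose)
qed

section \<open>Asymptotic stability\<close>

text \<open>Multiplication by the inverse flow makes the trajectory constant. At \<open>a\<close>
  only right continuity is assumed, because \<open>a\<close> may be an impulse time.\<close>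

lemma linear_flow_unique:
  fixes A :: "real^'n^'n" and x :: "real \<Rightarrow> real^'n"
  assumes cont: "continuous (at_right a) x"
    and deriv: "\<And>s. a < s \<Longrightarrow> s < b \<Longrightarrow> (x has_vector_derivative A *v x s) (at s)"
    and s: "a \<le> s" "s < b"
  shows "x s = mexp ((s - a) *\<^sub>R A) *v x a"
proof -
  define g where "g r = mexp ((a - r) *\<^sub>R A) *v x r" for r
  have d: "(g has_vector_derivative 0) (at r)" if "a < r" "r < b" for r
  proof -
    have "((\<lambda>r. mexp ((a - r) *\<^sub>R A)) has_vector_derivative - (A ** mexp ((a - r) *\<^sub>R A))) (at r)"
      using has_vector_derivative_mexp_affine [of a "-1" A r] by simp
    then have "(g has_vector_derivative (mexp ((a - r) *\<^sub>R A) *v (A *v x r)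
        + - (A ** mexp ((a - r) *\<^sub>R A)) *v x r)) (at r)"
      unfolding g_def
      by (rule bounded_bilinear.has_vector_derivative [OF bounded_bilinear_matrix_vector_mult])
        (use deriv that in auto)
    then show ?thesis
      by (simp add: matrix_vector_mul_assoc mexp_commute
          bounded_bilinear.minus_left [OF bounded_bilinear_matrix_vector_mult])
  qed
  have "continuous_on {a..s} g"
    unfolding continuous_on_eq_continuous_within
  proof
    fix r assume r: "r \<in> {a..s}"
    show "continuous (at r within {a..s}) g"
    proof (cases "r = a")
      case True
      have "continuous (at a within {a..s}) x"
      proof (cases "a < s")
        case True
        then show ?thesis using cont by (simp add: at_within_Icc_at_right)
      next
        case False
        then show ?thesis using s(1) by (simp add: continuous_within at_within_def)
      qed
      moreover have "continuous (at a within {a..s}) (\<lambda>r. mexp ((a - r) *\<^sub>R A))"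
        using has_vector_derivative_continuous [OF has_vector_derivative_mexp_affine [of a "-1" A a]]
        by simp
      ultimately show ?thesis
        unfolding True g_def
        by (intro bounded_bilinear.continuous [OF bounded_bilinear_matrix_vector_mult])
    next
      case False
      then show ?thesis
        using d [of r] r s by (auto intro: continuous_at_imp_continuous_at_within has_vector_derivative_continuous)
    qed
  qed
  \<comment> \<open>The point \<open>a\<close>, where \<open>g\<close> is only known to be
    continuous, is the exceptional set of the zero-derivative criterion.\<close>
  then have "g s = g a"
  proof (rule has_derivative_zero_unique_strong_interval [where k = "{a}", rotated])
    fix r assume "r \<in> {a..s} - {a}"
    then show "(g has_derivative (\<lambda>h. 0)) (at r within {a..s})"
      using has_derivative_at_withinI [OF d [of r, unfolded has_vector_derivative_def]] s by auto
  qed (use s in auto)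
  then have "mexp ((s - a) *\<^sub>R A) *v g s = mexp ((s - a) *\<^sub>R A) *v x a"
    by (simp add: g_def)
  then show ?thesis
    using mexp_uminus_inverse [of "s - a" A] by (simp add: g_def matrix_vector_mul_assoc)
qed

section \<open>Stability from a uniform decay estimate\<close>

lemma interval_of_partition:
  fixes t :: "nat \<Rightarrow> real"
  assumes "t 0 \<le> s" and "s < t m"
  obtains k where "k < m" and "t k \<le> s" and "s < t (Suc k)"
  using assms
proof (induction m arbitrary: thesis)
  case (Suc m)
  show ?case
  proof (cases "s < t m")
    case True
    then show ?thesis using Suc.IH Suc.prems less_SucI by metis
  next
    case False
    then show ?thesis using Suc.prems by (intro Suc.prems(1) [of m]) auto
  qed
qed simp

text \<open>The bound with \<rho> ^ k \<le> 1 gives Lyapunov stability, and \<rho> ^ k tending to 0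
  gives attraction, as late times lie in intervals of large index.\<close>

lemma asymptotically_stable_if_uniform_decay:
  fixes A J :: "real^'n^'n"
  assumes "0 < Tmin" and "0 \<le> C" and \<rho>: "0 < \<rho>" "\<rho> < 1"
    and decay: "\<And>t x0 x k s. \<lbrakk>admissible_times Tmin Tmax t; impulsive_solution A J t x0 x;
      t k \<le> s; s < t (Suc k)\<rbrakk> \<Longrightarrow> (norm (x s))\<^sup>2 \<le> C * \<rho> ^ k * (norm x0)\<^sup>2"
  shows "asymptotically_stable A J Tmin Tmax"
  unfolding asymptotically_stable_def lyapunov_stable_def
proof (intro allI impI conjI)
  fix t assume adm: "admissible_times Tmin Tmax t"
  have t0: "t 0 = 0" and step: "Tmin \<le> t (Suc k) - t k" for k
    using adm by (auto simp: admissible_times_def)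
  \<comment> \<open>Dwell times of at least \<open>Tmin\<close> > 0 exclude accumulation of
    impulses, so the intervals cover \<open>[0, \<infinity>)\<close>.\<close>
  have grow: "real k * Tmin \<le> t k" for k
  proof (induction k)
    case (Suc k)
    then show ?case using step [of k] by (simp add: algebra_simps)
  qed (simp add: t0)
  have "mono t"
    unfolding mono_iff_le_Suc using step \<open>0 < Tmin\<close> by (metis diff_ge_0_iff_ge less_imp_le order_trans)
  have locate: "\<exists>k. t k \<le> s \<and> s < t (Suc k)" if "0 \<le> s" for s
  proof -
    obtain m where "s / Tmin < real m"
      using reals_Archimedean2 by blast
    then have "s < t m"
      using grow [of m] \<open>0 < Tmin\<close> by (simp add: field_simps)
    then show ?thesis
      using interval_of_partition [of t s m] that t0 by auto
  qed
  {
    fix e :: real assume "e > 0"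
    \<comment> \<open>\<open>C + 1\<close> in place of \<open>C\<close> keeps the divisor positive
      and the final comparison strict even when \<open>C = 0\<close>.\<close>
    let ?d = "e / sqrt (C + 1)"
    have "norm (x s) < e" if small: "norm x0 < ?d" and x: "impulsive_solution A J t x0 x" and "0 \<le> s" for x0 x s
    proof -
      obtain k where k: "t k \<le> s" "s < t (Suc k)"
        using locate [OF \<open>0 \<le> s\<close>] by blast
      have "(norm (x s))\<^sup>2 \<le> C * \<rho> ^ k * (norm x0)\<^sup>2"
        by (rule decay [OF adm x k])
      also have "\<dots> \<le> C * 1 * (norm x0)\<^sup>2"
        using \<rho> \<open>0 \<le> C\<close> by (intro mult_right_mono mult_left_mono power_le_one) auto
      also have "\<dots> \<le> (C + 1) * (norm x0)\<^sup>2"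
        by (simp add: algebra_simps)
      also have "\<dots> < (C + 1) * ?d\<^sup>2"
        using small \<open>0 \<le> C\<close> by (intro mult_strict_left_mono power_strict_mono) auto
      also have "\<dots> = e\<^sup>2"
        using \<open>0 \<le> C\<close> by (simp add: power_divide)
      finally show ?thesis
        using \<open>e > 0\<close> by (simp add: power_less_imp_less_base)
    qed
    moreover have "?d > 0"
      using \<open>e > 0\<close> \<open>0 \<le> C\<close> by simp
    ultimately show "\<exists>d>0. \<forall>x0 x. norm x0 < d \<longrightarrow> impulsive_solution A J t x0 x \<longrightarrow> (\<forall>s\<ge>0. norm (x s) < e)"
      by blast
  }
  fix x0 x assume x: "impulsive_solution A J t x0 x"
  show "(x \<longlongrightarrow> 0) at_top"
    unfolding tendsto_iff dist_0_norm dist_norm diff_zero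
  proof (intro allI impI)
    fix e :: real assume "e > 0"
    have "(\<lambda>k. C * \<rho> ^ k * (norm x0)\<^sup>2) \<longlonglongrightarrow> C * 0 * (norm x0)\<^sup>2"
      using \<rho> by (intro tendsto_intros LIMSEQ_power_zero) auto
    then have "\<forall>\<^sub>F k in sequentially. C * \<rho> ^ k * (norm x0)\<^sup>2 < e\<^sup>2"
      using \<open>e > 0\<close> by (intro order_tendstoD) auto
    then obtain K where K: "\<And>k. k \<ge> K \<Longrightarrow> C * \<rho> ^ k * (norm x0)\<^sup>2 < e\<^sup>2"
      by (auto simp: eventually_sequentially)
    have "norm (x s) < e" if "t K \<le> s" for s
    proof -
      have "0 \<le> s"
        using that grow [of K] \<open>0 < Tmin\<close> by (meson less_imp_le mult_nonneg_nonneg of_nat_0_le_iff order_trans)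
      then obtain k where k: "t k \<le> s" "s < t (Suc k)"
        using locate by blast
      \<comment> \<open>Otherwise \<open>Suc k \<le> K\<close>, and monotonicity would give
        \<open>s < t (Suc k) \<le> t K \<le> s\<close>.\<close>
      have "K \<le> k"
        using monoD [OF \<open>mono t\<close>, of "Suc k" K] k(2) that by (metis not_less_eq_eq not_less order_trans)
      then have "(norm (x s))\<^sup>2 < e\<^sup>2"
        using decay [OF adm x k] K [of k] by linarith
      then show ?thesis
        using \<open>e > 0\<close> by (simp add: power_less_imp_less_base)
    qed
    then show "\<forall>\<^sub>F s in at_top. norm (x s) < e"
      by (auto simp: eventually_at_top_linorder)
  qed
qed

section \<open>Trajectories of the impulsive system\<close>

text \<open>No impulse lies strictly between consecutive times, so the linear flow applies there; by
  uniqueness of limits its value at the right end is the left limit to which \<open>J\<close> is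
  applied.\<close>

lemma impulsive_solution_flow:
  fixes A J :: "real^'n^'n"
  assumes "0 < Tmin" and adm: "admissible_times Tmin Tmax t" and x: "impulsive_solution A J t x0 x"
  shows "t k \<le> s \<Longrightarrow> s < t (Suc k) \<Longrightarrow> x s = mexp ((s - t k) *\<^sub>R A) *v x (t k)"
    and "x (t (Suc k)) = J *v (mexp ((t (Suc k) - t k) *\<^sub>R A) *v x (t k))"
proof -
  have t0: "t 0 = 0" and step: "t k < t (Suc k)" for k
    using adm \<open>0 < Tmin\<close> by (auto simp: admissible_times_def) (smt (verit))
  have "strict_mono t"
    using step by (simp add: strict_mono_Suc_iff)
  have nonneg: "0 \<le> t k" for k
    using strict_mono_mono [OF \<open>strict_mono t\<close>] t0 by (metis le0 monoD)
  have flow: "(x has_vector_derivative A *v x s) (at s within {0..})" if "s \<ge> 0" "s \<notin> t ` {1..}" for s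
    using x that by (simp add: impulsive_solution_def)
  have jump: "continuous (at_right (t k)) x"
    "\<exists>xminus. (x \<longlongrightarrow> xminus) (at_left (t k)) \<and> x (t k) = J *v xminus" if "k \<ge> 1" for k
    using x that by (simp_all add: impulsive_solution_def)
  \<comment> \<open>Time \<open>t 0\<close> carries no impulse, so right continuity there comes from
    the differential equation at 0 instead of the jump condition.\<close>
  have cont: "continuous (at_right (t k)) x"
  proof (cases "k = 0")
    case True
    have "t 0 < t j" if "j \<ge> 1" for j
      using that by (intro strict_monoD [OF \<open>strict_mono t\<close>]) simp
    then have "0 \<notin> t ` {1..}"
      by (metis atLeast_iff image_iff less_irrefl t0)
    then have "continuous (at 0 within {0..}) x"
      using has_vector_derivative_continuous [OF flow [of 0]] by simp
    then show ?thesis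
      unfolding True t0 by (rule continuous_within_subset) auto
  qed (use jump in auto)
  have deriv: "(x has_vector_derivative A *v x s) (at s)" if "t k < s" "s < t (Suc k)" for s
  proof -
    have "s \<notin> t ` {1..}"
    proof
      assume "s \<in> t ` {1..}"
      then obtain j where "s = t j" by blast
      then show False
        using that strict_mono_less [OF \<open>strict_mono t\<close>] by auto
    qed
    moreover have "s > 0"
      using nonneg [of k] that by linarith
    moreover from \<open>s > 0\<close> have "at s within {0..} = at s"
      by (intro at_within_interior) simp
    ultimately show ?thesis
      using flow [of s] by (metis less_imp_le)
  qed
  show eq: "x s = mexp ((s - t k) *\<^sub>R A) *v x (t k)" if "t k \<le> s" "s < t (Suc k)" for s
    using linear_flow_unique [OF cont deriv that] .
  obtain xm where xm: "(x \<longlongrightarrow> xm) (at_left (t (Suc k)))" "x (t (Suc k)) = J *v xm"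
    using jump(2) [of "Suc k"] by auto
  have "continuous (at (t (Suc k)) within {..<t (Suc k)}) (\<lambda>s. mexp ((s - t k) *\<^sub>R A) *v x (t k))"
    using has_vector_derivative_continuous [OF has_vector_derivative_mexp_affine
        [of "- t k" 1 A "t (Suc k)" "{..<t (Suc k)}"]]
    by (intro bounded_bilinear.continuous [OF bounded_bilinear_matrix_vector_mult] continuous_const) simp
  then have "((\<lambda>s. mexp ((s - t k) *\<^sub>R A) *v x (t k)) \<longlongrightarrow> mexp ((t (Suc k) - t k) *\<^sub>R A) *v x (t k))
      (at_left (t (Suc k)))"
    by (simp add: continuous_within)
  then have "(x \<longlongrightarrow> mexp ((t (Suc k) - t k) *\<^sub>R A) *v x (t k)) (at_left (t (Suc k)))"
  proof (rule Lim_transform_eventually)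
    show "\<forall>\<^sub>F s in at_left (t (Suc k)). mexp ((s - t k) *\<^sub>R A) *v x (t k) = x s"
      using eventually_at_left_real [OF step [of k]] 
      by eventually_elim (intro eq [symmetric], auto)
  qed
  then have "xm = mexp ((t (Suc k) - t k) *\<^sub>R A) *v x (t k)"
    using tendsto_unique [OF trivial_limit_at_left_real xm(1)] by blast
  then show "x (t (Suc k)) = J *v (mexp ((t (Suc k) - t k) *\<^sub>R A) *v x (t k))"
    using xm(2) by simp
qed

text \<open>The Lyapunov function is evaluated at the left limits \<open>y k = x(t\<^sub>k\<^sub>+\<^sub>1\<^sup>-)\<close>: condition (a) compares
  consecutive left limits, not consecutive post-jump values.\<close>

lemma discrete_time_imp_asymptotically_stable:
  fixes A J :: "real^'n^'n"
  assumes "0 < Tmin" and "Tmin \<le> Tmax" and "discrete_time_condition A J Tmin Tmax"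
  shows "asymptotically_stable A J Tmin Tmax"
proof -
  let ?\<Phi> = "\<lambda>\<theta>. mexp (\<theta> *\<^sub>R A)"
  obtain P where P: "pos_def P" and neg: "\<And>\<theta>. \<theta> \<in> {Tmin..Tmax} \<Longrightarrow>
      pos_def (P - transpose (?\<Phi> \<theta> ** J) ** P ** (?\<Phi> \<theta> ** J))"
    using assms(3) unfolding discrete_time_condition_def
    by (auto simp: mexp_transpose matrix_mul_assoc matrix_transpose_mul)
  have "continuous_on {Tmin..Tmax} (\<lambda>\<theta>. P - transpose (?\<Phi> \<theta> ** J) ** P ** (?\<Phi> \<theta> ** J))"
    by (intro continuous_on_diff bounded_bilinear.continuous_on [OF bounded_bilinear_matrix_matrix_mult]
        bounded_linear.continuous_on [OF bounded_linear_transpose] continuous_on_mexp continuous_on_const)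
  then obtain \<epsilon> where "\<epsilon> > 0" and \<epsilon>: "\<And>\<theta> v. \<theta> \<in> {Tmin..Tmax} \<Longrightarrow>
      \<epsilon> * (v \<bullet> v) \<le> v \<bullet> ((P - transpose (?\<Phi> \<theta> ** J) ** P ** (?\<Phi> \<theta> ** J)) *v v)"
    by (rule pos_def_uniform_bound [OF compact_Icc _ neg]) (assumption, rule that)
  obtain c where "c > 0" and c: "\<And>v. c * (v \<bullet> v) \<le> v \<bullet> (P *v v)"
    by (rule pos_def_uniform_bound [of "{0::real}" "\<lambda>_. P"]) (simp, simp, simp add: P, blast intro: that)
  obtain K where "K > 0" and K: "\<And>\<theta> v. \<theta> \<in> {0..Tmax} \<Longrightarrow> norm (?\<Phi> \<theta> *v v) \<le> K * norm v"
    by (rule matrix_vector_bound_compact [OF compact_Icc continuous_on_mexp]) (rule that)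
  obtain L where "L > 0" and L: "\<And>v. norm (J *v v) \<le> L * norm v"
    by (rule matrix_vector_bound_compact [of "{0::real}" "\<lambda>_. J"]) (simp, simp, blast intro: that)
  obtain b where "b > 0" and b: "\<And>v. norm (P *v v) \<le> b * norm v"
    by (rule matrix_vector_bound_compact [of "{0::real}" "\<lambda>_. P"]) (simp, simp, blast intro: that)
  \<comment> \<open>The maximum forces \<epsilon> < \<open>B\<close>, hence \<rho> > 0, which allows
    the later division by \<rho>.\<close>
  define B where "B = max b (2 * \<epsilon>)"
  define \<rho> where "\<rho> = 1 - \<epsilon> / B"
  have "B > 0" "\<epsilon> < B"
    using \<open>b > 0\<close> \<open>\<epsilon> > 0\<close> by (auto simp: B_def)
  then have \<rho>: "0 < \<rho>" "\<rho> < 1"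
    using \<open>\<epsilon> > 0\<close> by (simp_all add: \<rho>_def)
  have upper: "v \<bullet> (P *v v) \<le> B * (norm v)\<^sup>2" for v
  proof -
    have "v \<bullet> (P *v v) \<le> norm v * norm (P *v v)"
      by (rule norm_cauchy_schwarz)
    also have "\<dots> \<le> norm v * (B * norm v)"
      using b [of v] by (intro mult_left_mono order_trans [OF b] mult_right_mono) (auto simp: B_def)
    finally show ?thesis by (simp add: power2_eq_square mult_ac)
  qed
  have contract: "(?\<Phi> \<theta> *v (J *v v)) \<bullet> (P *v (?\<Phi> \<theta> *v (J *v v))) \<le> \<rho> * (v \<bullet> (P *v v))"
    if "\<theta> \<in> {Tmin..Tmax}" for \<theta> v
  proof -
    have "(?\<Phi> \<theta> *v (J *v v)) \<bullet> (P *v (?\<Phi> \<theta> *v (J *v v))) \<le> v \<bullet> (P *v v) - \<epsilon> * (norm v)\<^sup>2"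
      using \<epsilon> [OF that, of v]
      by (simp add: matrix_vector_mult_diff_rdistrib inner_diff_right quadratic_form_congruence
          dot_square_norm matrix_vector_mul_assoc)
    \<comment> \<open>The decrease is measured in the Euclidean norm; the upper bound on the form of
      \<open>P\<close> makes it a fixed fraction of that form.\<close>
    also have "\<epsilon> * (norm v)\<^sup>2 \<ge> \<epsilon> * (v \<bullet> (P *v v) / B)"
      using upper [of v] \<open>\<epsilon> > 0\<close> \<open>B > 0\<close> by (intro mult_left_mono) (auto simp: field_simps)
    then have "v \<bullet> (P *v v) - \<epsilon> * (norm v)\<^sup>2 \<le> \<rho> * (v \<bullet> (P *v v))"
      by (simp add: \<rho>_def algebra_simps)
    finally show ?thesis .
  qed
  show ?thesis
  proof (rule asymptotically_stable_if_uniform_decay [OF \<open>0 < Tmin\<close> _ \<rho>])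
    \<comment> \<open>The first summand serves \<open>k = 0\<close>. In the second, each
      \<open>K\<close> bounds a flow and \<open>L\<close> a jump, \<open>B / c\<close> compares the
      form of \<open>P\<close> with the norm, and 1/\<rho> corrects the index: after impulse
      \<open>k\<close> the last left limit is \<open>y (k - 1)\<close>.\<close>
    let ?C = "K\<^sup>2 + K\<^sup>2 * L\<^sup>2 * K\<^sup>2 * B / (c * \<rho>)"
    show "0 \<le> ?C"
      using \<open>B > 0\<close> \<open>c > 0\<close> \<rho> by simp
    fix t x0 x k s
    assume adm: "admissible_times Tmin Tmax t" and x: "impulsive_solution A J t x0 x"
      and s: "t k \<le> s" "s < t (Suc k)"
    have T: "t (Suc k) - t k \<in> {Tmin..Tmax}" for k
      using adm by (simp add: admissible_times_def)
    have start: "x (t 0) = x0"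
      using x by (simp add: impulsive_solution_def)
    note flow = impulsive_solution_flow [OF \<open>0 < Tmin\<close> adm x]
    define y where "y k = ?\<Phi> (t (Suc k) - t k) *v x (t k)" for k
    have y_Suc: "y (Suc k) = ?\<Phi> (t (Suc (Suc k)) - t (Suc k)) *v (J *v y k)" for k
      by (simp add: y_def flow(2) [of k])
    have "y k \<bullet> (P *v y k) \<le> \<rho> ^ k * (y 0 \<bullet> (P *v y 0))" for k
    proof (induction k)
      case (Suc k)
      have "y (Suc k) \<bullet> (P *v y (Suc k)) \<le> \<rho> * (y k \<bullet> (P *v y k))"
        unfolding y_Suc by (rule contract [OF T])
      also have "\<dots> \<le> \<rho> * (\<rho> ^ k * (y 0 \<bullet> (P *v y 0)))"
        using \<rho> by (intro mult_left_mono Suc) auto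
      finally show ?case by (simp add: mult_ac)
    qed simp
    \<comment> \<open>The first left limit is reached from \<open>x0\<close> by the flow alone,
      without a jump.\<close>
    moreover have y0: "(norm (y 0))\<^sup>2 \<le> K\<^sup>2 * (norm x0)\<^sup>2"
      using K [of "t (Suc 0) - t 0" x0] T [of 0] \<open>0 < Tmin\<close>
      by (auto simp: y_def start power_mult_distrib [symmetric] intro!: power_mono)
    ultimately have y_bound: "c * (norm (y k))\<^sup>2 \<le> \<rho> ^ k * (B * (K\<^sup>2 * (norm x0)\<^sup>2))" for k
    proof -
      have "c * (norm (y k))\<^sup>2 \<le> y k \<bullet> (P *v y k)"
        using c [of "y k"] by (simp add: dot_square_norm)
      also have "\<dots> \<le> \<rho> ^ k * (y 0 \<bullet> (P *v y 0))"
        by fact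
      also have "\<dots> \<le> \<rho> ^ k * (B * (K\<^sup>2 * (norm x0)\<^sup>2))"
        using \<rho> \<open>B > 0\<close> y0 by (intro mult_left_mono order_trans [OF upper]) auto
      finally show ?thesis .
    qed
    have "(norm (x s))\<^sup>2 \<le> (K * norm (x (t k)))\<^sup>2"
      using K [of "s - t k" "x (t k)"] s T [of k] by (intro power_mono) (auto simp: flow(1) [OF s])
    then have xs: "(norm (x s))\<^sup>2 \<le> K\<^sup>2 * (norm (x (t k)))\<^sup>2"
      by (simp add: power_mult_distrib)
    show "(norm (x s))\<^sup>2 \<le> ?C * \<rho> ^ k * (norm x0)\<^sup>2"
    proof (cases k)
      case 0
      have "K\<^sup>2 * (norm x0)\<^sup>2 \<le> ?C * (norm x0)\<^sup>2"
        using \<open>B > 0\<close> \<open>c > 0\<close> \<rho> by (intro mult_right_mono) auto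
      then show ?thesis
        using xs 0 start by simp
    next
      case (Suc j)
      \<comment> \<open>For \<open>k = Suc j\<close> the state at \<open>t k\<close> is
        \<open>J *v y j\<close>, which ties it to the contracting sequence.\<close>
      have "(norm (x (t k)))\<^sup>2 \<le> (L * norm (y j))\<^sup>2"
        unfolding Suc flow(2) [of j] y_def [symmetric] by (intro power_mono L) auto
      then have "K\<^sup>2 * (norm (x (t k)))\<^sup>2 \<le> K\<^sup>2 * (L\<^sup>2 * (norm (y j))\<^sup>2)"
        by (intro mult_left_mono) (auto simp: power_mult_distrib)
      also have "\<dots> \<le> K\<^sup>2 * (L\<^sup>2 * (\<rho> ^ j * (B * (K\<^sup>2 * (norm x0)\<^sup>2)) / c))"
        using y_bound [of j] \<open>c > 0\<close> by (intro mult_left_mono) (auto simp: field_simps)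
      also have "\<dots> = (K\<^sup>2 * L\<^sup>2 * K\<^sup>2 * B / (c * \<rho>)) * \<rho> ^ k * (norm x0)\<^sup>2"
        using \<rho> \<open>c > 0\<close> by (simp add: Suc field_simps)
      also have "\<dots> \<le> ?C * \<rho> ^ k * (norm x0)\<^sup>2"
        using \<rho> by (intro mult_right_mono) auto
      finally show ?thesis
        using xs by linarith
    qed
  qed
qed

theorem corollary4p2:
  fixes A J :: "real^'n^'n" and \<delta> Tmin Tmax :: real
  assumes "0 < \<delta>" and "\<delta> \<le> Tmin" and "Tmin \<le> Tmax"
  shows "(discrete_time_condition A J Tmin Tmax \<longleftrightarrow> looped_functional_condition A J Tmin Tmax)
    \<and> (discrete_time_condition A J Tmin Tmax \<longrightarrow> asymptotically_stable A J Tmin Tmax)"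
proof -
  have "0 < Tmin"
    using assms by linarith
  then show ?thesis
    using discrete_time_imp_looped_functional looped_functional_imp_discrete_time
      discrete_time_imp_asymptotically_stable assms(3) by blast
qed

end
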